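(* Let $(X,\xi)$ and $(Y,\eta)$ be pointed coarse spaces and let $f,g\colon (X,\xi)\to(Y,\eta)$ be coarse maps. If $f$ and $g$ are bornotopic, then $\iota f=\iota g$ as maps $\iota(X,\xi)\to\iota(Y,\eta)$.
   Context: Work in a nonstandard universe, with extension map $A\mapsto{}^{\ast}A$, satisfying the transfer principle and the saturation principle (every family of internal sets that has the finite intersection property and is indexed by a standard set has nonempty intersection). A coarse structure on a set $X$ is a family $\mathcal{C}_X$ of binary relations on $X$ that contains the diagonal $\Delta_X$ and is closed under subsets, finite unions, compositions and inverses; a coarse space is a set with a coarse structure. A set $B\subseteq X$ is bounded if $B\times B\in\mathcal{C}_X$. A pointed coarse space $(X,\xi)$ is a coarse space $X$ with a base point $\xi\in X$; maps $f\colon(X,\xi)\to(Y,\eta)$ satisfy $f(\xi)=\eta$. Such a map is proper if the inverse image of each bounded set of $Y$ containing $\eta$ is bounded in $X$; it is bornologous if $(f\times f)(E)\in\mathcal{C}_Y$ for all $E\in\mathcal{C}_X$; it is coarse if it is proper and bornologous. Two maps $f,g\colon X\to Y$ are bornotopic (close) if $\{(f(x),g(x)) : x\in X\}\in\mathcal{C}_Y$. For $x,y\in{}^{\ast}X$ write $x\sim_X y$ (finitely close) if $(x,y)\in{}^{\ast}E$ for some $E\in\mathcal{C}_X$. Let $\mathrm{FIN}(X,\xi)=\{x\in{}^{\ast}X : x\sim_X\xi\}$ and $\mathrm{INF}(X,\xi)={}^{\ast}X\setminus\mathrm{FIN}(X,\xi)$. For $x,y\in\mathrm{INF}(X,\xi)$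 write $x\equiv^{\iota}_{X,\xi}y$ if there are $n\in{}^{\ast}\mathbb{N}$ and an internal hyperfinite sequence $\{s_i\}_{i\le n}$ of points of $\mathrm{INF}(X,\xi)$ with $s_0=x$, $s_n=y$ and $s_i\sim_X s_{i+1}$ for all $i<n$. This is an equivalence relation; $[x]^{\iota}_{X,\xi}$ denotes the class of $x$, and $\iota(X,\xi)=\{[x]^{\iota}_{X,\xi} : x\in\mathrm{INF}(X,\xi)\}$. A coarse map $f\colon(X,\xi)\to(Y,\eta)$ induces the (well-defined) map $\iota f\colon\iota(X,\xi)\to\iota(Y,\eta)$, $\iota f([x]^{\iota}_{X,\xi})=[{}^{\ast}f(x)]^{\iota}_{Y,\eta}$. *)

theory Defs
  imports "HOL-Library.FuncSet"
begin

section \<open>Nonstandard universes\<close>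

text \<open>
  A universe is a type of objects with a binary membership relation. All notions below are
  relative to such a relation, so that they can be read both in the standard and in the
  internal universe.
\<close>

definition elts :: "('a \<Rightarrow> 'a \<Rightarrow> bool) \<Rightarrow> 'a \<Rightarrow> 'a set" where
  "elts mem a = {z. mem z a}"

text \<open>The object \<open>p\<close> is the Kuratowski pair of \<open>a\<close> and \<open>b\<close>.\<close>

definition is_pair :: "('a \<Rightarrow> 'a \<Rightarrow> bool) \<Rightarrow> 'a \<Rightarrow> 'a \<Rightarrow> 'a \<Rightarrow> bool" where
  "is_pair mem p a b \<longleftrightarrow> elts mem ` elts mem p = {{a}, {a, b}}"

definition is_rel :: "('a \<Rightarrow> 'a \<Rightarrow> bool) \<Rightarrow> 'a \<Rightarrow> ('a \<times> 'a) set \<Rightarrow> bool" where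
  "is_rel mem r R \<longleftrightarrow> elts mem r = {p. \<exists>(a, b)\<in>R. is_pair mem p a b}"

definition rel_of :: "('a \<Rightarrow> 'a \<Rightarrow> bool) \<Rightarrow> 'a \<Rightarrow> ('a \<times> 'a) set" where
  "rel_of mem r = {(a, b). \<exists>p\<in>elts mem r. is_pair mem p a b}"

text \<open>
  Bounded formulas of the language of set theory, with named variables;
  \<open>BAll i j \<phi>\<close> stands for \<open>\<forall>x\<^sub>i \<in> x\<^sub>j. \<phi>\<close>. Parameters enter through the valuation.
\<close>

datatype bfm = Mem nat nat | Eq nat nat | Neg bfm | Conj bfm bfm | BAll nat nat bfm

primrec sat :: "('a \<Rightarrow> 'a \<Rightarrow> bool) \<Rightarrow> (nat \<Rightarrow> 'a) \<Rightarrow> bfm \<Rightarrow> bool" where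
  "sat mem e (Mem i j) \<longleftrightarrow> mem (e i) (e j)"
| "sat mem e (Eq i j) \<longleftrightarrow> e i = e j"
| "sat mem e (Neg \<phi>) \<longleftrightarrow> \<not> sat mem e \<phi>"
| "sat mem e (Conj \<phi> \<psi>) \<longleftrightarrow> sat mem e \<phi> \<and> sat mem e \<psi>"
| "sat mem e (BAll i j \<phi>) \<longleftrightarrow> (\<forall>z. mem z (e j) \<longrightarrow> sat mem (e(i := z)) \<phi>)"

record ('u, 'v) universes =
  smem :: "'u \<Rightarrow> 'u \<Rightarrow> bool"
  imem :: "'v \<Rightarrow> 'v \<Rightarrow> bool"
  star :: "'u \<Rightarrow> 'v"
  num :: "nat \<Rightarrow> 'u"

text \<open>An object is internal if it is an element of a standard set \<open>*A\<close>.\<close>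

definition internal :: "('u, 'v) universes \<Rightarrow> 'v \<Rightarrow> bool" where
  "internal W v \<longleftrightarrow> (\<exists>A. imem W v (star W A))"

text \<open>
  The axioms on the standard universe are deliberately few, so that they hold in superstructures,
  in the cumulative levels \<open>V\<^sub>\<kappa>\<close> for limit \<open>\<kappa> > \<omega>\<close>, and in the sets hereditarily of size
  less than an uncountable regular cardinal.
  \<^item> Extensionality is required for nonempty sets only: an object without elements may be an
    individual (urelement).
  \<^item> Separation is second order: every subset of a standard set is a standard set.
  \<^item> Power sets are not required, only a set containing the finite subsets of a given set;
    this already provides products and sets of finite sequences. A universe closed under all
    power sets that is also a HOL type could not be shown to exist in HOL.
  \<^item> The natural numbers are coded by \<open>num\<close> rather than as von Neumann ordinals, because
    superstructures do not contain the set of the latter (natural numbers are individuals there).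
\<close>

locale nonstandard_universe =
  fixes W :: "('u, 'v) universes"
  assumes extensionality:
      "elts (smem W) a \<noteq> {} \<Longrightarrow> elts (smem W) a = elts (smem W) b \<Longrightarrow> a = b"
    and pairing: "\<exists>c. elts (smem W) c = {a, b}"
    and union: "\<exists>c. elts (smem W) c = \<Union> (elts (smem W) ` elts (smem W) a)"
    and separation: "S \<subseteq> elts (smem W) a \<Longrightarrow> \<exists>c. elts (smem W) c = S"
    and finite_subsets:
      "\<exists>c. \<forall>S. finite S \<and> S \<subseteq> elts (smem W) a \<longrightarrow> (\<exists>b\<in>elts (smem W) c. elts (smem W) b = S)"
    and naturals: "inj (num W)" "\<exists>c. elts (smem W) c = range (num W)"
    and transfer: "sat (smem W) e \<phi> \<longleftrightarrow> sat (imem W) (star W \<circ> e) \<phi>"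
    and saturation:
      "\<lbrakk>\<And>i. i \<in> elts (smem W) I \<Longrightarrow> internal W (A i);
        \<And>J. finite J \<Longrightarrow> J \<subseteq> elts (smem W) I \<Longrightarrow> \<exists>x. \<forall>i\<in>J. imem W x (A i)\<rbrakk>
       \<Longrightarrow> \<exists>x. \<forall>i\<in>elts (smem W) I. imem W x (A i)"

text \<open>
  Extensions of standard sets, relations and maps, as HOL sets, relations and functions on
  internal objects. The choice of the representing object is relevant for the empty set only,
  where it does not affect the result.
\<close>

definition star_set :: "('u, 'v) universes \<Rightarrow> 'u set \<Rightarrow> 'v set" where
  "star_set W A = elts (imem W) (star W (SOME a. elts (smem W) a = A))"

definition star_rel :: "('u, 'v) universes \<Rightarrow> ('u \<times> 'u) set \<Rightarrow> ('v \<times> 'v) set" where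
  "star_rel W R = rel_of (imem W) (star W (SOME r. is_rel (smem W) r R))"

definition star_fun :: "('u, 'v) universes \<Rightarrow> 'u set \<Rightarrow> ('u \<Rightarrow> 'u) \<Rightarrow> 'v \<Rightarrow> 'v" where
  "star_fun W A f x = (THE y. (x, y) \<in> star_rel W ((\<lambda>a. (a, f a)) ` A))"

definition hnat :: "('u, 'v) universes \<Rightarrow> 'v set" where
  "hnat W = star_set W (range (num W))"

definition hle :: "('u, 'v) universes \<Rightarrow> 'v \<Rightarrow> 'v \<Rightarrow> bool" where
  "hle W i j \<longleftrightarrow> (i, j) \<in> star_rel W {(num W k, num W l) | k l. k \<le> l}"

definition hless :: "('u, 'v) universes \<Rightarrow> 'v \<Rightarrow> 'v \<Rightarrow> bool" where
  "hless W i j \<longleftrightarrow> (i, j) \<in> star_rel W {(num W k, num W l) | k l. k < l}"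

definition hsuc :: "('u, 'v) universes \<Rightarrow> 'v \<Rightarrow> 'v" where
  "hsuc W i = (THE j. (i, j) \<in> star_rel W {(num W k, num W (Suc k)) | k. True})"

text \<open>The object \<open>s\<close> is an internal sequence \<open>(s\<^sub>i)\<close> indexed by the \<open>i \<le> n\<close> in \<open>*\<nat>\<close>.\<close>

definition hyperfinite_seq :: "('u, 'v) universes \<Rightarrow> 'v \<Rightarrow> 'v \<Rightarrow> bool" where
  "hyperfinite_seq W n s \<longleftrightarrow>
     n \<in> hnat W \<and> internal W s \<and>
     (\<forall>p\<in>elts (imem W) s. \<exists>i z. is_pair (imem W) p i z) \<and>
     single_valued (rel_of (imem W) s) \<and>
     Domain (rel_of (imem W) s) = {i \<in> hnat W. hle W i n}"

definition seq_at :: "('u, 'v) universes \<Rightarrow> 'v \<Rightarrow> 'v \<Rightarrow> 'v" where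
  "seq_at W s i = (THE z. (i, z) \<in> rel_of (imem W) s)"


section \<open>Pointed coarse spaces\<close>

record 'a pcs =
  pts :: "'a set"
  ents :: "('a \<times> 'a) set set"
  base :: 'a

definition coarse_structure :: "'a set \<Rightarrow> ('a \<times> 'a) set set \<Rightarrow> bool" where
  "coarse_structure A C \<longleftrightarrow>
     C \<subseteq> Pow (A \<times> A) \<and> Id_on A \<in> C \<and>
     (\<forall>E\<in>C. \<forall>F. F \<subseteq> E \<longrightarrow> F \<in> C) \<and>
     (\<forall>E\<in>C. \<forall>F\<in>C. E \<union> F \<in> C) \<and>
     (\<forall>E\<in>C. \<forall>F\<in>C. E O F \<in> C) \<and>
     (\<forall>E\<in>C. E\<inverse> \<in> C)"

definition pointed_coarse_space :: "'a pcs \<Rightarrow> bool" where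
  "pointed_coarse_space X \<longleftrightarrow> coarse_structure (pts X) (ents X) \<and> base X \<in> pts X"

definition bounded_set :: "'a pcs \<Rightarrow> 'a set \<Rightarrow> bool" where
  "bounded_set X B \<longleftrightarrow> B \<subseteq> pts X \<and> B \<times> B \<in> ents X"

definition pointed_map :: "'a pcs \<Rightarrow> 'b pcs \<Rightarrow> ('a \<Rightarrow> 'b) \<Rightarrow> bool" where
  "pointed_map X Y f \<longleftrightarrow> f \<in> pts X \<rightarrow> pts Y \<and> f (base X) = base Y"

definition proper_map :: "'a pcs \<Rightarrow> 'b pcs \<Rightarrow> ('a \<Rightarrow> 'b) \<Rightarrow> bool" where
  "proper_map X Y f \<longleftrightarrow>
     (\<forall>B. bounded_set Y B \<and> base Y \<in> B \<longrightarrow> bounded_set X (f -` B \<inter> pts X))"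

definition bornologous :: "'a pcs \<Rightarrow> 'b pcs \<Rightarrow> ('a \<Rightarrow> 'b) \<Rightarrow> bool" where
  "bornologous X Y f \<longleftrightarrow> (\<forall>E\<in>ents X. map_prod f f ` E \<in> ents Y)"

definition coarse_map :: "'a pcs \<Rightarrow> 'b pcs \<Rightarrow> ('a \<Rightarrow> 'b) \<Rightarrow> bool" where
  "coarse_map X Y f \<longleftrightarrow> pointed_map X Y f \<and> proper_map X Y f \<and> bornologous X Y f"

definition bornotopic :: "'a pcs \<Rightarrow> 'b pcs \<Rightarrow> ('a \<Rightarrow> 'b) \<Rightarrow> ('a \<Rightarrow> 'b) \<Rightarrow> bool" where
  "bornotopic X Y f g \<longleftrightarrow> {(f x, g x) | x. x \<in> pts X} \<in> ents Y"

text \<open>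
  The underlying set and the coarse structure belong to the standard universe. For the coarse
  structure this has to be said, as the standard universe need not be closed under power sets.
\<close>

definition standard_pcs :: "('u, 'v) universes \<Rightarrow> 'u pcs \<Rightarrow> bool" where
  "standard_pcs W X \<longleftrightarrow>
     (\<exists>a. elts (smem W) a = pts X) \<and>
     (\<exists>c. ents X = {E. \<exists>e\<in>elts (smem W) c. is_rel (smem W) e E})"


section \<open>The invariant \<open>\<iota>\<close>\<close>

definition finitely_close :: "('u, 'v) universes \<Rightarrow> 'u pcs \<Rightarrow> 'v \<Rightarrow> 'v \<Rightarrow> bool" where
  "finitely_close W X x y \<longleftrightarrow> (\<exists>E\<in>ents X. (x, y) \<in> star_rel W E)"

definition FIN_pts :: "('u, 'v) universes \<Rightarrow> 'u pcs \<Rightarrow> 'v set" where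
  "FIN_pts W X = {x \<in> star_set W (pts X). finitely_close W X x (star W (base X))}"

definition INF_pts :: "('u, 'v) universes \<Rightarrow> 'u pcs \<Rightarrow> 'v set" where
  "INF_pts W X = star_set W (pts X) - FIN_pts W X"

definition iota_equiv :: "('u, 'v) universes \<Rightarrow> 'u pcs \<Rightarrow> 'v \<Rightarrow> 'v \<Rightarrow> bool" where
  "iota_equiv W X x y \<longleftrightarrow>
     x \<in> INF_pts W X \<and> y \<in> INF_pts W X \<and>
     (\<exists>n s. hyperfinite_seq W n s \<and>
        (\<forall>i\<in>hnat W. hle W i n \<longrightarrow> seq_at W s i \<in> INF_pts W X) \<and>
        seq_at W s (star W (num W 0)) = x \<and> seq_at W s n = y \<and>
        (\<forall>i\<in>hnat W. hless W i n \<longrightarrow>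
           finitely_close W X (seq_at W s i) (seq_at W s (hsuc W i))))"

definition iota_class :: "('u, 'v) universes \<Rightarrow> 'u pcs \<Rightarrow> 'v \<Rightarrow> 'v set" where
  "iota_class W X x = {y. iota_equiv W X x y}"

definition iota :: "('u, 'v) universes \<Rightarrow> 'u pcs \<Rightarrow> 'v set set" where
  "iota W X = iota_class W X ` INF_pts W X"

text \<open>
  The image of a class \<open>c\<close> is the common value of \<open>[*f(x)]\<close> for \<open>x \<in> c\<close>. Maps on \<open>\<iota>(X,\<xi>)\<close> are
  extensional functions, so equality of HOL functions is equality of maps.
\<close>

definition iota_map ::
  "('u, 'v) universes \<Rightarrow> 'u pcs \<Rightarrow> 'u pcs \<Rightarrow> ('u \<Rightarrow> 'u) \<Rightarrow> 'v set \<Rightarrow> 'v set" where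
  "iota_map W X Y f =
     (\<lambda>c\<in>iota W X. the_elem ((\<lambda>x. iota_class W Y (star_fun W (pts X) f x)) ` c))"

end

theory Submission imports Defs begin

text \<open>
  For \<open>x \<in> INF(X,\<xi>)\<close> the points \<open>*f(x)\<close> and \<open>*g(x)\<close> are infinite, because \<open>f\<close> and \<open>g\<close> are proper
  (\<open>star_fun_INF\<close>), and they are finitely close, because the entourage \<open>{(f(a), g(a)) | a \<in> X}\<close> of \<open>Y\<close>
  extends to one containing \<open>(*f(x), *g(x))\<close> (\<open>star_fun_close\<close>). If a hyperfinite chain leads from
  \<open>*f(x)\<close> to \<open>z\<close>, putting \<open>*g(x)\<close> in front of it gives a chain from \<open>*g(x)\<close> to \<open>z\<close>
  (\<open>iota_equiv_prepend\<close>), so by symmetry the two points have the same class. The images of a class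
  under \<open>x \<mapsto> [*f(x)]\<close> and under \<open>x \<mapsto> [*g(x)]\<close> are then the same set of classes; their common
  value is obtained from that set, so neither the well-definedness of \<open>\<iota>f\<close> nor the transitivity of
  \<open>\<equiv>\<^sup>\<iota>\<close> is used.

  The nonstandard input is transfer. Statements about extended relations, such as
  \<open>*R O *Q \<subseteq> *T\<close> if \<open>R O Q \<subseteq> T\<close>, come from short bounded formulas. That the prolonged chain
  exists as an internal object is the transfer of the corresponding fact about finite sequences
  (\<open>internal_prepend\<close>); since the standard universe need not have power sets, the new sequence is bounded by
  a set containing all finite relations on a given set.
\<close>

section \<open>Bounded formulas for pairs and relations\<close>

definition disj_fm :: "bfm \<Rightarrow> bfm \<Rightarrow> bfm" where
  "disj_fm \<phi> \<psi> = Neg (Conj (Neg \<phi>) (Neg \<psi>))"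

definition imp_fm :: "bfm \<Rightarrow> bfm \<Rightarrow> bfm" where
  "imp_fm \<phi> \<psi> = Neg (Conj \<phi> (Neg \<psi>))"

definition bex_fm :: "nat \<Rightarrow> nat \<Rightarrow> bfm \<Rightarrow> bfm" where
  "bex_fm i j \<phi> = Neg (BAll i j (Neg \<phi>))"

lemma sat_connectives [simp]:
  "sat mem e (disj_fm \<phi> \<psi>) \<longleftrightarrow> sat mem e \<phi> \<or> sat mem e \<psi>"
  "sat mem e (imp_fm \<phi> \<psi>) \<longleftrightarrow> (sat mem e \<phi> \<longrightarrow> sat mem e \<psi>)"
  "sat mem e (bex_fm i j \<phi>) \<longleftrightarrow> (\<exists>z. mem z (e j) \<and> sat mem (e(i := z)) \<phi>)"
  by (auto simp: disj_fm_def imp_fm_def bex_fm_def)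

text \<open>
  The formula \<open>u = {a, b}\<close>. Here and in the formulas with variable indices below, bound variables
  are numbered above all arguments, so that the satisfaction lemmas hold for arbitrary indices. These
  lemmas are stated for an arbitrary membership relation and read the same in both universes.
\<close>

definition doubleton_fm :: "nat \<Rightarrow> nat \<Rightarrow> nat \<Rightarrow> bfm" where
  "doubleton_fm u a b =
     (let z = Suc (u + a + b)
      in Conj (Mem a u) (Conj (Mem b u) (BAll z u (disj_fm (Eq z a) (Eq z b)))))"

lemma sat_doubleton_fm [simp]:
  "sat mem e (doubleton_fm u a b) \<longleftrightarrow> elts mem (e u) = {e a, e b}"
proof -
  have "elts mem (e u) = {e a, e b} \<longleftrightarrow>
      mem (e a) (e u) \<and> mem (e b) (e u) \<and> (\<forall>z. mem z (e u) \<longrightarrow> z = e a \<or> z = e b)"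
    unfolding elts_def by blast
  then show ?thesis by (simp add: doubleton_fm_def)
qed

text \<open>
  The formula \<open>p = (a, b)\<close>: the elements of \<open>p\<close> are sets of the form \<open>{a}\<close> or \<open>{a, b}\<close>, and both occur.
\<close>

definition pair_fm :: "nat \<Rightarrow> nat \<Rightarrow> nat \<Rightarrow> bfm" where
  "pair_fm p a b =
     (let u = Suc (p + a + b)
      in Conj (BAll u p (disj_fm (doubleton_fm u a a) (doubleton_fm u a b)))
           (Conj (bex_fm u p (doubleton_fm u a a)) (bex_fm u p (doubleton_fm u a b))))"

lemma image_eq_doubleton_iff:
  "f ` A = {x, y} \<longleftrightarrow> (\<forall>z\<in>A. f z = x \<or> f z = y) \<and> (\<exists>z\<in>A. f z = x) \<and> (\<exists>z\<in>A. f z = y)"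
proof -
  have "f ` A = {x, y} \<longleftrightarrow> f ` A \<subseteq> {x, y} \<and> x \<in> f ` A \<and> y \<in> f ` A" by blast
  also have "\<dots> \<longleftrightarrow> (\<forall>z\<in>A. f z = x \<or> f z = y) \<and> (\<exists>z\<in>A. f z = x) \<and> (\<exists>z\<in>A. f z = y)"
    by (simp add: image_subset_iff image_iff eq_commute)
  finally show ?thesis .
qed

lemma sat_pair_fm [simp]:
  "sat mem e (pair_fm p a b) \<longleftrightarrow> is_pair mem (e p) (e a) (e b)"
  unfolding is_pair_def image_eq_doubleton_iff elts_def[of mem "e p"]
  by (simp add: pair_fm_def)

text \<open>The formula \<open>(a, b) \<in> r\<close>.\<close>

definition rel_fm :: "nat \<Rightarrow> nat \<Rightarrow> nat \<Rightarrow> bfm" where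
  "rel_fm r a b = bex_fm (Suc (r + a + b)) r (pair_fm (Suc (r + a + b)) a b)"

lemma sat_rel_fm [simp]:
  "sat mem e (rel_fm r a b) \<longleftrightarrow> (e a, e b) \<in> rel_of mem (e r)"
  by (simp add: rel_fm_def rel_of_def elts_def)

lemma is_pair_inject:
  assumes "is_pair mem p a b" and "is_pair mem p c d"
  shows "a = c" and "b = d"
proof -
  have "{{a}, {a, b}} = {{c}, {c, d}}" using assms by (simp add: is_pair_def)
  then show "a = c" and "b = d" by (auto simp: doubleton_eq_iff)
qed


section \<open>Transfer of relations\<close>

context nonstandard_universe
begin

lemma transfer_nth:
  "sat (smem W) ((!) es) \<phi> \<longleftrightarrow> sat (imem W) (\<lambda>i. star W (es ! i)) \<phi>"
  using transfer[of "(!) es" \<phi>] by (simp add: comp_def)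

lemma star_elts_mono:
  assumes "elts (smem W) a \<subseteq> elts (smem W) b"
  shows "elts (imem W) (star W a) \<subseteq> elts (imem W) (star W b)"
  using assms transfer_nth[of "[a, b]" "BAll 2 0 (Mem 2 1)"] by (auto simp: elts_def)

lemma star_set_elts: "star_set W (elts (smem W) a) = elts (imem W) (star W a)"
proof -
  have "elts (smem W) (SOME c. elts (smem W) c = elts (smem W) a) = elts (smem W) a"
    by (rule someI) (rule refl)
  then show ?thesis
    unfolding star_set_def using star_elts_mono by (metis subset_antisym subset_refl)
qed

lemma pair_exists: "\<exists>p. is_pair (smem W) p a b"
proof -
  obtain u where u: "elts (smem W) u = {a}" using pairing[of a a] by auto
  obtain v where v: "elts (smem W) v = {a, b}" using pairing by blast
  obtain p where "elts (smem W) p = {u, v}" using pairing by blast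
  then have "is_pair (smem W) p a b" using u v by (simp add: is_pair_def)
  then show ?thesis ..
qed

text \<open>
  By extensionality, which covers \<open>{a}\<close> and \<open>{a, b}\<close> as they are nonempty, a pair in the standard
  universe is determined by its components.
\<close>

lemma is_pair_elts:
  assumes "is_pair (smem W) p a b" and "elts (smem W) u = {a}" and "elts (smem W) v = {a, b}"
  shows "elts (smem W) p = {u, v}"
proof -
  have eq: "elts (smem W) ` elts (smem W) p = {elts (smem W) u, elts (smem W) v}"
    using assms by (simp add: is_pair_def)
  have "w \<in> {u, v}" if "w \<in> elts (smem W) p" for w
  proof -
    have "elts (smem W) w \<in> {elts (smem W) u, elts (smem W) v}" using eq that by blast
    then show ?thesis using extensionality[of u w] extensionality[of v w] assms(2,3) by auto
  qed
  moreover have "u \<in> elts (smem W) p"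
  proof -
    have "elts (smem W) u \<in> elts (smem W) ` elts (smem W) p" unfolding eq by simp
    then obtain w where "w \<in> elts (smem W) p" "elts (smem W) w = elts (smem W) u" by (metis imageE)
    then show ?thesis using extensionality[of u w] assms(2) by auto
  qed
  moreover have "v \<in> elts (smem W) p"
  proof -
    have "elts (smem W) v \<in> elts (smem W) ` elts (smem W) p" unfolding eq by simp
    then obtain w where "w \<in> elts (smem W) p" "elts (smem W) w = elts (smem W) v" by (metis imageE)
    then show ?thesis using extensionality[of v w] assms(3) by auto
  qed
  ultimately show ?thesis by blast
qed

lemma is_pair_unique:
  assumes "is_pair (smem W) p a b" and "is_pair (smem W) q a b"
  shows "p = q"
proof -
  obtain u where u: "elts (smem W) u = {a}" using pairing[of a a] by auto
  obtain v where v: "elts (smem W) v = {a, b}" using pairing by blast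
  show ?thesis
    using is_pair_elts[OF assms(1) u v] is_pair_elts[OF assms(2) u v] extensionality[of p q] by auto
qed

lemma rel_of_is_rel:
  assumes "is_rel (smem W) r R"
  shows "rel_of (smem W) r = R"
proof -
  have "(a, b) \<in> rel_of (smem W) r \<longleftrightarrow> (a, b) \<in> R" for a b
  proof
    assume "(a, b) \<in> rel_of (smem W) r"
    then obtain p where "p \<in> elts (smem W) r" and p: "is_pair (smem W) p a b"
      by (auto simp: rel_of_def)
    then obtain c d where "(c, d) \<in> R" "is_pair (smem W) p c d"
      using assms by (auto simp: is_rel_def)
    then show "(a, b) \<in> R" using is_pair_inject[OF p] by metis
  next
    assume ab: "(a, b) \<in> R"
    obtain p where p: "is_pair (smem W) p a b" using pair_exists by metis
    then have "p \<in> elts (smem W) r" using ab assms by (auto simp: is_rel_def)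
    then show "(a, b) \<in> rel_of (smem W) r" using p by (auto simp: rel_of_def)
  qed
  then show ?thesis by auto
qed

lemma union2_exists: "\<exists>c. elts (smem W) c = elts (smem W) a \<union> elts (smem W) b"
proof -
  obtain d where "elts (smem W) d = {a, b}" using pairing by blast
  then show ?thesis using union[of d] by simp
qed

text \<open>
  The pair \<open>{{x}, {x, y}}\<close> is a finite set of finite subsets, so applying the finite-subset
  axiom twice bounds all pairs over a set, and a third application bounds all finite relations.
\<close>

lemma pairs_exist:
  "\<exists>P. \<forall>x\<in>elts (smem W) a. \<forall>y\<in>elts (smem W) a. \<forall>p. is_pair (smem W) p x y \<longrightarrow> p \<in> elts (smem W) P"
proof -
  obtain c where c: "\<forall>S. finite S \<and> S \<subseteq> elts (smem W) a \<longrightarrow> (\<exists>b\<in>elts (smem W) c. elts (smem W) b = S)"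
    using finite_subsets[of a] ..
  obtain d where d: "\<forall>S. finite S \<and> S \<subseteq> elts (smem W) c \<longrightarrow> (\<exists>b\<in>elts (smem W) d. elts (smem W) b = S)"
    using finite_subsets[of c] ..
  have "p \<in> elts (smem W) d"
    if xy: "x \<in> elts (smem W) a" "y \<in> elts (smem W) a" and p: "is_pair (smem W) p x y" for x y p
  proof -
    obtain u where u: "u \<in> elts (smem W) c" "elts (smem W) u = {x}"
      using c[rule_format, of "{x}"] xy(1) by (metis empty_subsetI finite.emptyI finite.insertI insert_subset)
    obtain v where v: "v \<in> elts (smem W) c" "elts (smem W) v = {x, y}"
      using c[rule_format, of "{x, y}"] xy by (metis empty_subsetI finite.emptyI finite.insertI insert_subset)
    obtain q where "q \<in> elts (smem W) d" "elts (smem W) q = {u, v}"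
      using d[rule_format, of "{u, v}"] u(1) v(1) by (metis empty_subsetI finite.emptyI finite.insertI insert_subset)
    then show ?thesis using is_pair_elts[OF p u(2) v(2)] extensionality[of p q] by auto
  qed
  then show ?thesis by blast
qed

lemma is_rel_exists:
  assumes "R \<subseteq> elts (smem W) a \<times> elts (smem W) a"
  shows "\<exists>r. is_rel (smem W) r R"
proof -
  obtain P where P: "\<And>x y p. x \<in> elts (smem W) a \<Longrightarrow> y \<in> elts (smem W) a \<Longrightarrow> is_pair (smem W) p x y
      \<Longrightarrow> p \<in> elts (smem W) P"
    using pairs_exist[of a] by blast
  have "{p. \<exists>(x, y)\<in>R. is_pair (smem W) p x y} \<subseteq> elts (smem W) P"
    using P assms by blast
  then show ?thesis unfolding is_rel_def by (rule separation)
qed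

lemma finite_rels_exist:
  "\<exists>c. \<forall>R. finite R \<and> R \<subseteq> elts (smem W) a \<times> elts (smem W) a \<longrightarrow>
     (\<exists>r\<in>elts (smem W) c. is_rel (smem W) r R)"
proof -
  obtain P where P: "\<And>x y p. x \<in> elts (smem W) a \<Longrightarrow> y \<in> elts (smem W) a \<Longrightarrow> is_pair (smem W) p x y
      \<Longrightarrow> p \<in> elts (smem W) P"
    using pairs_exist[of a] by blast
  obtain c where c: "\<forall>S. finite S \<and> S \<subseteq> elts (smem W) P \<longrightarrow> (\<exists>b\<in>elts (smem W) c. elts (smem W) b = S)"
    using finite_subsets[of P] ..
  have "\<exists>r\<in>elts (smem W) c. is_rel (smem W) r R"
    if "finite R" and R: "R \<subseteq> elts (smem W) a \<times> elts (smem W) a" for R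
  proof -
    let ?S = "{p. \<exists>(x, y)\<in>R. is_pair (smem W) p x y}"
    have "?S \<subseteq> elts (smem W) P" using P R by blast
    moreover have "?S \<subseteq> (\<lambda>(x, y). SOME p. is_pair (smem W) p x y) ` R"
    proof
      fix p assume "p \<in> ?S"
      then obtain x y where xy: "(x, y) \<in> R" "is_pair (smem W) p x y" by blast
      have "(SOME p. is_pair (smem W) p x y) = p"
        using xy(2) is_pair_unique by (metis someI)
      then show "p \<in> (\<lambda>(x, y). SOME p. is_pair (smem W) p x y) ` R" using xy(1) by force
    qed
    then have "finite ?S" using \<open>finite R\<close> by (meson finite_imageI finite_subset)
    ultimately show ?thesis unfolding is_rel_def using c by simp
  qed
  then show ?thesis by blast
qed

text \<open>The extension of a relation does not depend on the object chosen to represent it.\<close>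

lemma star_rel_is_rel:
  assumes "is_rel (smem W) r R"
  shows "star_rel W R = rel_of (imem W) (star W r)"
proof -
  define r' where "r' = (SOME r. is_rel (smem W) r R)"
  have "is_rel (smem W) r' R" unfolding r'_def using assms by (rule someI)
  then have "elts (smem W) r' = elts (smem W) r" using assms by (simp add: is_rel_def)
  then have "elts (imem W) (star W r') = elts (imem W) (star W r)"
    using star_elts_mono by (metis subset_antisym subset_refl)
  then show ?thesis by (simp add: star_rel_def rel_of_def flip: r'_def)
qed

lemma star_rel_obtain:
  assumes "R \<subseteq> elts (smem W) a \<times> elts (smem W) a"
  obtains r where "rel_of (smem W) r = R" and "star_rel W R = rel_of (imem W) (star W r)"
    and "is_rel (smem W) r R"
proof -
  obtain r where "is_rel (smem W) r R" using is_rel_exists[OF assms] ..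
  then show thesis using that[of r] rel_of_is_rel star_rel_is_rel by simp
qed

lemma star_rel_mem:
  assumes "R \<subseteq> elts (smem W) a \<times> elts (smem W) a" and "(x, y) \<in> R"
  shows "(star W x, star W y) \<in> star_rel W R"
proof -
  obtain r where "rel_of (smem W) r = R" "star_rel W R = rel_of (imem W) (star W r)"
    using star_rel_obtain[OF assms(1)] .
  then show ?thesis using assms(2) transfer_nth[of "[r, x, y]" "rel_fm 0 1 2"] by simp
qed

lemma star_rel_subset_Times:
  assumes "R \<subseteq> elts (smem W) a \<times> elts (smem W) a"
    and "R \<subseteq> elts (smem W) b \<times> elts (smem W) c"
  shows "star_rel W R \<subseteq> elts (imem W) (star W b) \<times> elts (imem W) (star W c)"
proof -
  obtain r where r: "star_rel W R = rel_of (imem W) (star W r)" "is_rel (smem W) r R"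
    using star_rel_obtain[OF assms(1)] .
  let ?\<phi> = "BAll 3 0 (bex_fm 4 1 (bex_fm 5 2 (pair_fm 3 4 5)))"
  have "\<exists>x\<in>elts (smem W) b. \<exists>y\<in>elts (smem W) c. is_pair (smem W) p x y" if p: "p \<in> elts (smem W) r" for p
  proof -
    obtain x y where "(x, y) \<in> R" "is_pair (smem W) p x y"
      using p r(2) by (auto simp: is_rel_def)
    then show ?thesis using assms(2) by blast
  qed
  then have "sat (smem W) ((!) [r, b, c]) ?\<phi>"
    by (simp add: elts_def Bex_def)
  then have *: "\<forall>p. imem W p (star W r) \<longrightarrow> (\<exists>x. imem W x (star W b) \<and>
      (\<exists>y. imem W y (star W c) \<and> is_pair (imem W) p x y))"
    unfolding transfer_nth by simp
  show ?thesis
  proof (clarsimp simp: r(1))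
    fix x y assume "(x, y) \<in> rel_of (imem W) (star W r)"
    then obtain p where "imem W p (star W r)" "is_pair (imem W) p x y"
      by (auto simp: rel_of_def elts_def)
    then show "x \<in> elts (imem W) (star W b) \<and> y \<in> elts (imem W) (star W c)"
      using * is_pair_inject[of "imem W" p x y] unfolding elts_def by (metis mem_Collect_eq)
  qed
qed

lemma star_rel_comp:
  assumes "R \<subseteq> elts (smem W) a \<times> elts (smem W) a" and "Q \<subseteq> elts (smem W) a \<times> elts (smem W) a"
    and "T \<subseteq> elts (smem W) a \<times> elts (smem W) a" and "R O Q \<subseteq> T"
  shows "star_rel W R O star_rel W Q \<subseteq> star_rel W T"
proof -
  obtain r where r: "rel_of (smem W) r = R" "star_rel W R = rel_of (imem W) (star W r)"
    using star_rel_obtain[OF assms(1)] .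
  obtain q where q: "rel_of (smem W) q = Q" "star_rel W Q = rel_of (imem W) (star W q)"
    using star_rel_obtain[OF assms(2)] .
  obtain t where t: "rel_of (smem W) t = T" "star_rel W T = rel_of (imem W) (star W t)"
    using star_rel_obtain[OF assms(3)] .
  let ?\<phi> = "BAll 4 0 (BAll 5 0 (BAll 6 0
      (imp_fm (Conj (rel_fm 1 4 5) (rel_fm 2 5 6)) (rel_fm 3 4 6))))"
  have "sat (smem W) ((!) [a, r, q, t]) ?\<phi>"
    using assms(4) by (auto simp: r(1) q(1) t(1))
  then have *: "(x, z) \<in> star_rel W T"
    if "x \<in> elts (imem W) (star W a)" "y \<in> elts (imem W) (star W a)" "z \<in> elts (imem W) (star W a)"
      "(x, y) \<in> star_rel W R" "(y, z) \<in> star_rel W Q" for x y z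
    unfolding transfer_nth using that by (simp add: elts_def r(2) q(2) t(2))
  show ?thesis
    using * star_rel_subset_Times[OF assms(1,1)] star_rel_subset_Times[OF assms(2,2)] by blast
qed

lemma star_rel_converse:
  assumes "R \<subseteq> elts (smem W) a \<times> elts (smem W) a"
  shows "(star_rel W R)\<inverse> \<subseteq> star_rel W (R\<inverse>)"
proof -
  obtain r where r: "rel_of (smem W) r = R" "star_rel W R = rel_of (imem W) (star W r)"
    using star_rel_obtain[OF assms(1)] .
  have R': "R\<inverse> \<subseteq> elts (smem W) a \<times> elts (smem W) a" using assms by blast
  obtain q where q: "rel_of (smem W) q = R\<inverse>" "star_rel W (R\<inverse>) = rel_of (imem W) (star W q)"
    using star_rel_obtain[OF R'] .
  let ?\<phi> = "BAll 3 0 (BAll 4 0 (imp_fm (rel_fm 1 3 4) (rel_fm 2 4 3)))"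
  have "sat (smem W) ((!) [a, r, q]) ?\<phi>"
    by (auto simp: r(1) q(1))
  then have *: "(y, x) \<in> star_rel W (R\<inverse>)"
    if "x \<in> elts (imem W) (star W a)" "y \<in> elts (imem W) (star W a)" "(x, y) \<in> star_rel W R" for x y
    unfolding transfer_nth using that by (simp add: elts_def r(2) q(2))
  show ?thesis
    using * star_rel_subset_Times[OF assms(1,1)] by blast
qed

lemma star_rel_single_valued:
  assumes "R \<subseteq> elts (smem W) a \<times> elts (smem W) a" and "single_valued R"
  shows "single_valued (star_rel W R)"
proof -
  obtain r where r: "rel_of (smem W) r = R" "star_rel W R = rel_of (imem W) (star W r)"
    using star_rel_obtain[OF assms(1)] .
  let ?\<phi> = "BAll 2 0 (BAll 3 0 (BAll 4 0
      (imp_fm (Conj (rel_fm 1 2 3) (rel_fm 1 2 4)) (Eq 3 4))))"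
  have "sat (smem W) ((!) [a, r]) ?\<phi>"
    using assms(2) by (auto simp: r(1) single_valued_def)
  then have *: "y = z"
    if "x \<in> elts (imem W) (star W a)" "y \<in> elts (imem W) (star W a)" "z \<in> elts (imem W) (star W a)"
      "(x, y) \<in> star_rel W R" "(x, z) \<in> star_rel W R" for x y z
    unfolding transfer_nth using that by (simp add: elts_def r(2))
  show ?thesis
    unfolding single_valued_def using * star_rel_subset_Times[OF assms(1,1)] by blast
qed

lemma star_rel_total:
  assumes "R \<subseteq> elts (smem W) a \<times> elts (smem W) a" and "elts (smem W) b \<subseteq> Domain R"
  shows "elts (imem W) (star W b) \<subseteq> Domain (star_rel W R)"
proof -
  obtain r where r: "rel_of (smem W) r = R" "star_rel W R = rel_of (imem W) (star W r)"
    using star_rel_obtain[OF assms(1)] .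
  let ?\<phi> = "BAll 3 1 (bex_fm 4 0 (rel_fm 2 3 4))"
  have "sat (smem W) ((!) [a, b, r]) ?\<phi>"
    using assms by (fastforce simp: r(1) elts_def)
  then show ?thesis
    unfolding transfer_nth by (auto simp add: elts_def r(2))
qed

end


section \<open>Prepending a point to a hyperfinite sequence\<close>

text \<open>
  The object \<open>s\<close> is a sequence of points of \<open>y\<close> indexed by the elements of \<open>N\<close> up to \<open>n\<close> in the
  order \<open>le\<close>. All quantifiers are bounded, so that \<open>seq_fm\<close> expresses this in both universes.
\<close>

definition seq_on :: "('a \<Rightarrow> 'a \<Rightarrow> bool) \<Rightarrow> 'a \<Rightarrow> 'a \<Rightarrow> 'a \<Rightarrow> 'a \<Rightarrow> 'a \<Rightarrow> bool" where
  "seq_on mem N y le n s \<longleftrightarrow>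
     (\<forall>p. mem p s \<longrightarrow> (\<exists>i. mem i N \<and> (\<exists>z. mem z y \<and> is_pair mem p i z))) \<and>
     (\<forall>i. mem i N \<longrightarrow> (\<forall>z. mem z y \<longrightarrow> (\<forall>w. mem w y \<longrightarrow>
        (i, z) \<in> rel_of mem s \<and> (i, w) \<in> rel_of mem s \<longrightarrow> z = w))) \<and>
     (\<forall>i. mem i N \<longrightarrow> ((i, n) \<in> rel_of mem le \<longleftrightarrow> (\<exists>z. mem z y \<and> (i, z) \<in> rel_of mem s)))"

definition seq_fm :: "nat \<Rightarrow> nat \<Rightarrow> nat \<Rightarrow> nat \<Rightarrow> nat \<Rightarrow> bfm" where
  "seq_fm N y le n s =
     (let k = Suc (N + y + le + n + s) in
      Conj (BAll k s (bex_fm (k + 1) N (bex_fm (k + 2) y (pair_fm k (k + 1) (k + 2)))))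
        (Conj (BAll k N (BAll (k + 1) y (BAll (k + 2) y
                (imp_fm (Conj (rel_fm s k (k + 1)) (rel_fm s k (k + 2))) (Eq (k + 1) (k + 2))))))
          (BAll k N (Conj (imp_fm (rel_fm le k n) (bex_fm (k + 1) y (rel_fm s k (k + 1))))
             (imp_fm (bex_fm (k + 1) y (rel_fm s k (k + 1))) (rel_fm le k n))))))"

lemma sat_seq_fm [simp]:
  "sat mem e (seq_fm N y le n s) \<longleftrightarrow> seq_on mem (e N) (e y) (e le) (e n) (e s)"
  by (simp add: seq_fm_def seq_on_def iff_conv_conj_imp)

lemma seq_on_iff:
  "seq_on mem N y le n s \<longleftrightarrow>
     (\<forall>p\<in>elts mem s. \<exists>i z. is_pair mem p i z) \<and>
     rel_of mem s \<subseteq> elts mem N \<times> elts mem y \<and> single_valued (rel_of mem s) \<and>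
     Domain (rel_of mem s) = {i \<in> elts mem N. (i, n) \<in> rel_of mem le}"
  (is "?L \<longleftrightarrow> ?R")
proof
  assume L: ?L
  have sub: "i \<in> elts mem N \<and> z \<in> elts mem y" if iz: "(i, z) \<in> rel_of mem s" for i z
  proof -
    obtain p where p: "mem p s" "is_pair mem p i z" using iz by (auto simp: rel_of_def elts_def)
    then obtain j w where "mem j N" "mem w y" "is_pair mem p j w"
      using L unfolding seq_on_def by metis
    then show ?thesis using is_pair_inject[OF p(2)] by (auto simp: elts_def)
  qed
  have "\<forall>p\<in>elts mem s. \<exists>i z. is_pair mem p i z"
    using L unfolding seq_on_def elts_def by (metis mem_Collect_eq)
  moreover have "single_valued (rel_of mem s)"
    using L sub unfolding seq_on_def single_valued_def elts_def by (metis mem_Collect_eq)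
  moreover have "i \<in> Domain (rel_of mem s) \<longleftrightarrow> i \<in> {i \<in> elts mem N. (i, n) \<in> rel_of mem le}" for i
    using L sub unfolding seq_on_def elts_def by (metis Domain_iff mem_Collect_eq)
  ultimately show ?R using sub by auto
next
  assume R: ?R
  have "\<exists>i. mem i N \<and> (\<exists>z. mem z y \<and> is_pair mem p i z)" if p: "mem p s" for p
  proof -
    obtain i z where iz: "is_pair mem p i z" using R p by (auto simp: elts_def)
    then have "(i, z) \<in> rel_of mem s" using p by (auto simp: rel_of_def elts_def)
    then have "mem i N \<and> mem z y" using R by (auto simp: elts_def)
    then show ?thesis using iz by blast
  qed
  moreover have "(i, n) \<in> rel_of mem le \<longleftrightarrow> (\<exists>z. mem z y \<and> (i, z) \<in> rel_of mem s)"
    if i: "mem i N" for i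
  proof -
    have "i \<in> Domain (rel_of mem s) \<longleftrightarrow> (i, n) \<in> rel_of mem le" using R i by (simp add: elts_def)
    moreover have "mem z y" if "(i, z) \<in> rel_of mem s" for z using R that by (auto simp: elts_def)
    ultimately show ?thesis by (auto simp: Domain_iff)
  qed
  moreover have "z = w" if "(i, z) \<in> rel_of mem s" "(i, w) \<in> rel_of mem s" for i z w
    using R that by (auto dest: single_valuedD)
  ultimately show ?L unfolding seq_on_def by (intro conjI allI impI) auto
qed

lemma THE_single_valued:
  assumes "single_valued R" and "(x, y) \<in> R"
  shows "(THE z. (x, z) \<in> R) = y"
  using assms(2) by (rule the_equality) (use assms in \<open>auto dest: single_valuedD\<close>)

context nonstandard_universe
begin

lemma mem_finite_seq_iff:
  "(num W i, z) \<in> (\<lambda>k. (num W k, h k)) ` {..m} \<longleftrightarrow> i \<le> m \<and> z = h i"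
  by (auto simp: inj_eq[OF naturals(1)])

lemma seq_on_standardE:
  assumes N: "elts (smem W) N = range (num W)"
    and le: "rel_of (smem W) le = {(num W k, num W l) | k l. k \<le> l}"
    and "seq_on (smem W) N y le (num W m) s"
  obtains h where "rel_of (smem W) s = (\<lambda>k. (num W k, h k)) ` {..m}" and "h ` {..m} \<subseteq> elts (smem W) y"
proof -
  define R where "R = rel_of (smem W) s"
  have R: "R \<subseteq> range (num W) \<times> elts (smem W) y" "single_valued R"
    and D: "Domain R = {i \<in> range (num W). (i, num W m) \<in> rel_of (smem W) le}"
    using assms(3) unfolding seq_on_iff N R_def[symmetric] by auto
  have D': "num W k \<in> Domain R \<longleftrightarrow> k \<le> m" for k
    unfolding D le using naturals(1) by (auto dest: injD)
  define h where "h k = (THE z. (num W k, z) \<in> R)" for k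
  have h: "(num W k, z) \<in> R \<longleftrightarrow> k \<le> m \<and> z = h k" for k z
  proof
    assume "(num W k, z) \<in> R"
    then show "k \<le> m \<and> z = h k"
      using D' THE_single_valued[OF R(2)] unfolding h_def by (metis DomainI)
  next
    assume kz: "k \<le> m \<and> z = h k"
    then obtain w where "(num W k, w) \<in> R" using D' by (metis DomainE)
    then show "(num W k, z) \<in> R"
      using kz THE_single_valued[OF R(2)] unfolding h_def by metis
  qed
  have "p \<in> R \<longleftrightarrow> p \<in> (\<lambda>k. (num W k, h k)) ` {..m}" for p
    using R(1) h mem_finite_seq_iff[of _ _ h m] by (cases p) (force simp: image_iff)
  then have eq: "R = (\<lambda>k. (num W k, h k)) ` {..m}" by blast
  moreover have "h ` {..m} \<subseteq> elts (smem W) y" using R(1) unfolding eq by auto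
  ultimately show thesis using that[of h] unfolding R_def by simp
qed

lemma seq_on_standardI:
  assumes N: "elts (smem W) N = range (num W)"
    and le: "rel_of (smem W) le = {(num W k, num W l) | k l. k \<le> l}"
    and s: "is_rel (smem W) s ((\<lambda>k. (num W k, h k)) ` {..m})"
    and h: "h ` {..m} \<subseteq> elts (smem W) y"
  shows "seq_on (smem W) N y le (num W m) s"
proof -
  let ?R = "(\<lambda>k. (num W k, h k)) ` {..m}"
  have "Domain ?R = {i \<in> range (num W). (i, num W m) \<in> rel_of (smem W) le}"
    unfolding le using naturals(1) by (auto simp: Domain_iff image_iff dest: injD)
  moreover have "single_valued ?R"
    using naturals(1) by (auto simp: single_valued_def dest: injD)
  moreover have "?R \<subseteq> range (num W) \<times> elts (smem W) y" using h by auto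
  moreover have "\<forall>p\<in>elts (smem W) s. \<exists>i z. is_pair (smem W) p i z"
    using s by (auto simp: is_rel_def)
  ultimately show ?thesis
    unfolding seq_on_iff rel_of_is_rel[OF s] N by simp
qed

end

text \<open>
  The sequence \<open>s'\<close> of length \<open>n'\<close> starts at \<open>b\<close>, ends where the sequence \<open>s\<close> of length \<open>n\<close> ends,
  has no values other than \<open>b\<close> and those of \<open>s\<close>, and each pair of consecutive values is either
  \<open>(b, s\<^sub>0)\<close> or a pair of consecutive values of \<open>s\<close>. The objects \<open>lt\<close>, \<open>sc\<close> and \<open>z0\<close> are the order, the
  successor relation and zero.
\<close>

definition prepended ::
  "('a \<Rightarrow> 'a \<Rightarrow> bool) \<Rightarrow> 'a \<Rightarrow> 'a \<Rightarrow> 'a \<Rightarrow> 'a \<Rightarrow> 'a \<Rightarrow> 'a \<Rightarrow> 'a \<Rightarrow> 'a \<Rightarrow> 'a \<Rightarrow> 'a \<Rightarrow> bool" where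
  "prepended mem N y lt sc z0 n s b n' s' \<longleftrightarrow>
     (z0, b) \<in> rel_of mem s' \<and>
     (\<exists>z. mem z y \<and> (n', z) \<in> rel_of mem s' \<and> (n, z) \<in> rel_of mem s) \<and>
     (\<forall>i. mem i N \<longrightarrow> (\<forall>z. mem z y \<longrightarrow> (i, z) \<in> rel_of mem s' \<longrightarrow>
        z = b \<or> (\<exists>j. mem j N \<and> (j, z) \<in> rel_of mem s))) \<and>
     (\<forall>i. mem i N \<longrightarrow> (i, n') \<in> rel_of mem lt \<longrightarrow>
        (\<exists>k. mem k N \<and> (\<exists>u. mem u y \<and> (\<exists>v. mem v y \<and>
          (i, k) \<in> rel_of mem sc \<and> (i, u) \<in> rel_of mem s' \<and> (k, v) \<in> rel_of mem s' \<and>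
          (u = b \<and> (z0, v) \<in> rel_of mem s \<or>
           (\<exists>j. mem j N \<and> (\<exists>l. mem l N \<and> (j, n) \<in> rel_of mem lt \<and> (j, l) \<in> rel_of mem sc \<and>
              (j, u) \<in> rel_of mem s \<and> (l, v) \<in> rel_of mem s)))))))"

text \<open>
  The formula for \<open>prepended\<close>, with its arguments at the fixed indices \<open>0, \<dots>, 4\<close> and \<open>6, \<dots>, 10\<close>.
\<close>

definition prepended_fm :: bfm where
  "prepended_fm =
     Conj (rel_fm 10 4 8)
    (Conj (bex_fm 11 1 (Conj (rel_fm 10 9 11) (rel_fm 7 6 11)))
    (Conj (BAll 11 0 (BAll 12 1 (imp_fm (rel_fm 10 11 12)
        (disj_fm (Eq 12 8) (bex_fm 13 0 (rel_fm 7 13 12))))))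
      (BAll 11 0 (imp_fm (rel_fm 2 11 9)
        (bex_fm 12 0 (bex_fm 13 1 (bex_fm 14 1
          (Conj (rel_fm 3 11 12) (Conj (rel_fm 10 11 13) (Conj (rel_fm 10 12 14)
            (disj_fm (Conj (Eq 13 8) (rel_fm 7 4 14))
              (bex_fm 15 0 (bex_fm 16 0 (Conj (rel_fm 2 15 6) (Conj (rel_fm 3 15 16)
                (Conj (rel_fm 7 15 13) (rel_fm 7 16 14)))))))))))))))))"

lemma sat_prepended_fm [simp]:
  "sat mem e prepended_fm \<longleftrightarrow>
     prepended mem (e 0) (e 1) (e 2) (e 3) (e 4) (e 6) (e 7) (e 8) (e 9) (e 10)"
  by (simp add: prepended_fm_def prepended_def)

context nonstandard_universe
begin

text \<open>
  In the standard universe the new sequence is \<open>b, h 0, \<dots>, h m\<close>, whose \<open>k\<close>-th term is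
  \<open>case_nat b h k\<close>.
\<close>

lemma prepended_standard:
  assumes N: "elts (smem W) N = range (num W)"
    and lt: "rel_of (smem W) lt = {(num W k, num W l) | k l. k < l}"
    and sc: "rel_of (smem W) sc = {(num W k, num W (Suc k)) | k. True}"
    and s: "rel_of (smem W) s = (\<lambda>k. (num W k, h k)) ` {..m}" and h: "h ` {..m} \<subseteq> elts (smem W) y"
    and s': "rel_of (smem W) s' = (\<lambda>k. (num W k, case_nat b h k)) ` {..Suc m}"
    and b: "smem W b y"
  shows "prepended (smem W) N y lt sc (num W 0) (num W m) s b (num W (Suc m)) s'"
proof -
  have N_mem: "smem W z N \<longleftrightarrow> z \<in> range (num W)" for z using N by (auto simp: elts_def)
  have y_mem: "smem W (h k) y" if "k \<le> m" for k using h that by (auto simp: elts_def image_subset_iff)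
  have s_iff: "(num W i, z) \<in> rel_of (smem W) s \<longleftrightarrow> i \<le> m \<and> z = h i" for i z
    unfolding s by (rule mem_finite_seq_iff)
  have s'_iff: "(num W i, z) \<in> rel_of (smem W) s' \<longleftrightarrow> i \<le> Suc m \<and> z = case_nat b h i" for i z
    unfolding s' by (rule mem_finite_seq_iff)
  have lt_iff: "(num W i, num W j) \<in> rel_of (smem W) lt \<longleftrightarrow> i < j" for i j
    unfolding lt by (auto simp: inj_eq[OF naturals(1)])
  have sc_mem: "(num W i, num W (Suc i)) \<in> rel_of (smem W) sc" for i
    unfolding sc by blast
  have start: "(num W 0, b) \<in> rel_of (smem W) s'" by (simp add: s'_iff)
  have finish: "smem W (h m) y \<and> (num W (Suc m), h m) \<in> rel_of (smem W) s' \<and>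
      (num W m, h m) \<in> rel_of (smem W) s"
    by (simp add: s'_iff s_iff y_mem)
  have vals: "z = b \<or> (\<exists>j. smem W j N \<and> (j, z) \<in> rel_of (smem W) s)"
    if i: "smem W i N" and iz: "(i, z) \<in> rel_of (smem W) s'" for i z
  proof -
    obtain k where k: "i = num W k" using i N_mem by blast
    show ?thesis
    proof (cases k)
      case 0
      then show ?thesis using iz k by (simp add: s'_iff)
    next
      case (Suc j)
      then have "(num W j, z) \<in> rel_of (smem W) s" using iz k by (simp add: s'_iff s_iff)
      then show ?thesis using N_mem by blast
    qed
  qed
  have adjacent: "\<exists>k. smem W k N \<and> (\<exists>u. smem W u y \<and> (\<exists>v. smem W v y \<and>
          (i, k) \<in> rel_of (smem W) sc \<and> (i, u) \<in> rel_of (smem W) s' \<and> (k, v) \<in> rel_of (smem W) s' \<and>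
          (u = b \<and> (num W 0, v) \<in> rel_of (smem W) s \<or>
           (\<exists>j. smem W j N \<and> (\<exists>l. smem W l N \<and> (j, num W m) \<in> rel_of (smem W) lt \<and>
              (j, l) \<in> rel_of (smem W) sc \<and> (j, u) \<in> rel_of (smem W) s \<and> (l, v) \<in> rel_of (smem W) s)))))"
    if iN: "smem W i N" and i: "(i, num W (Suc m)) \<in> rel_of (smem W) lt" for i
  proof -
    obtain p where p: "i = num W p" using iN N_mem by blast
    then have "p \<le> m" using i by (simp add: lt_iff)
    have ends: "smem W (num W (Suc p)) N" "smem W (h p) y" "(num W p, num W (Suc p)) \<in> rel_of (smem W) sc"
      "(num W (Suc p), h p) \<in> rel_of (smem W) s'"
      using \<open>p \<le> m\<close> by (simp_all add: N_mem y_mem sc_mem s'_iff)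
    show ?thesis
    proof (cases p)
      case 0
      have "(num W 0, h p) \<in> rel_of (smem W) s" using 0 by (simp add: s_iff)
      then show ?thesis using ends start b p 0 by blast
    next
      case (Suc j)
      have "smem W (h j) y" "(num W p, h j) \<in> rel_of (smem W) s'" "smem W (num W j) N"
        "smem W (num W p) N" "(num W j, num W m) \<in> rel_of (smem W) lt"
        "(num W j, num W p) \<in> rel_of (smem W) sc" "(num W j, h j) \<in> rel_of (smem W) s"
        "(num W p, h p) \<in> rel_of (smem W) s"
        using \<open>p \<le> m\<close> Suc by (simp_all add: N_mem y_mem sc_mem s'_iff s_iff lt_iff)
      then show ?thesis using ends p by blast
    qed
  qed
  show ?thesis
    unfolding prepended_def using start finish vals adjacent by blast
qed

text \<open>
  The transferred formula quantifies over the sequences in a standard set \<open>A\<close> with \<open>s \<in> *A\<close>, and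
  takes the prolonged ones from a set \<open>C\<close> that contains all finite relations on \<open>N \<union> y\<close>.
\<close>

lemma internal_prepend:
  assumes N: "elts (smem W) N = range (num W)"
    and le: "rel_of (smem W) le = {(num W k, num W l) | k l. k \<le> l}"
    and lt: "rel_of (smem W) lt = {(num W k, num W l) | k l. k < l}"
    and sc: "rel_of (smem W) sc = {(num W k, num W (Suc k)) | k. True}"
    and n: "imem W n (star W N)" and s: "internal W s" and b: "imem W b (star W y)"
    and seq: "seq_on (imem W) (star W N) (star W y) (star W le) n s"
  obtains n' s' where "imem W n' (star W N)" and "internal W s'"
    and "seq_on (imem W) (star W N) (star W y) (star W le) n' s'"
    and "prepended (imem W) (star W N) (star W y) (star W lt) (star W sc) (star W (num W 0)) n s b n' s'"
proof -
  obtain c where c: "elts (smem W) c = elts (smem W) N \<union> elts (smem W) y"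
    using union2_exists by blast
  obtain C where C: "\<forall>R. finite R \<and> R \<subseteq> elts (smem W) c \<times> elts (smem W) c \<longrightarrow>
      (\<exists>r\<in>elts (smem W) C. is_rel (smem W) r R)"
    using finite_rels_exist[of c] ..
  obtain A where A: "imem W s (star W A)" using s by (auto simp: internal_def)
  \<comment> \<open>Indices 5, 17 and 18, which do not occur in \<open>prepended_fm\<close>, stand for \<open>le\<close>, \<open>A\<close> and \<open>C\<close>.\<close>
  let ?\<phi> = "BAll 6 0 (BAll 7 17 (BAll 8 1 (imp_fm (seq_fm 0 1 5 6 7)
      (bex_fm 9 0 (bex_fm 10 18 (Conj (seq_fm 0 1 5 9 10) prepended_fm))))))"
  let ?e = "((!) [N, y, lt, sc, num W 0, le])(17 := A, 18 := C)"
  have std: "\<exists>n'. smem W n' N \<and> (\<exists>s'. smem W s' C \<and> seq_on (smem W) N y le n' s' \<and>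
      prepended (smem W) N y lt sc (num W 0) n s b n' s')"
    if n: "smem W n N" and b: "smem W b y" and seq: "seq_on (smem W) N y le n s" for n s b
  proof -
    obtain m where m: "n = num W m" using n N by (auto simp: elts_def)
    obtain h where R: "rel_of (smem W) s = (\<lambda>k. (num W k, h k)) ` {..m}"
      and h: "h ` {..m} \<subseteq> elts (smem W) y"
      using seq_on_standardE[OF N le seq[unfolded m]] .
    let ?R' = "(\<lambda>k. (num W k, case_nat b h k)) ` {..Suc m}"
    have "case_nat b h k \<in> elts (smem W) y" if "k \<le> Suc m" for k
      using h b that by (cases k) (auto simp: elts_def image_subset_iff)
    then have h': "case_nat b h ` {..Suc m} \<subseteq> elts (smem W) y" by blast
    then have "?R' \<subseteq> elts (smem W) c \<times> elts (smem W) c"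
      unfolding c N by auto
    then have "\<exists>r\<in>elts (smem W) C. is_rel (smem W) r ?R'"
      using C by simp
    then obtain s' where s': "smem W s' C" "is_rel (smem W) s' ?R'"
      by (auto simp: elts_def)
    have "seq_on (smem W) N y le (num W (Suc m)) s'"
      using N le s'(2) h' by (rule seq_on_standardI)
    moreover have "prepended (smem W) N y lt sc (num W 0) n s b (num W (Suc m)) s'"
      unfolding m using N lt sc R h rel_of_is_rel[OF s'(2)] b by (rule prepended_standard)
    moreover have "smem W (num W (Suc m)) N" using N by (auto simp: elts_def)
    ultimately show ?thesis using s'(1) by blast
  qed
  have "sat (smem W) ?e ?\<phi>"
    using std by simp
  then have "sat (imem W) (star W \<circ> ?e) ?\<phi>"
    using transfer by metis
  then obtain n' s' where "imem W n' (star W N)" "imem W s' (star W C)"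
    "seq_on (imem W) (star W N) (star W y) (star W le) n' s'"
    "prepended (imem W) (star W N) (star W y) (star W lt) (star W sc) (star W (num W 0)) n s b n' s'"
    using n A b seq by (simp add: fun_upd_comp) blast
  then show thesis using that internal_def by metis
qed

text \<open>
  The chain from \<open>a\<close> to \<open>z\<close> is prolonged by \<open>b\<close>. Its steps are then \<open>b, a\<close> and those of the given
  chain, and its points are \<open>b\<close> and those of the given chain, hence infinite.
\<close>

lemma iota_equiv_prepend:
  assumes y: "elts (smem W) y = pts Y"
    and b: "b \<in> INF_pts W Y" and close: "finitely_close W Y b a"
    and az: "iota_equiv W Y a z"
  shows "iota_equiv W Y b z"
proof -
  obtain N where N: "elts (smem W) N = range (num W)" using naturals(2) by blast
  have LE: "{(num W k, num W l) | k l. k \<le> l} \<subseteq> elts (smem W) N \<times> elts (smem W) N"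
    and LT: "{(num W k, num W l) | k l. k < l} \<subseteq> elts (smem W) N \<times> elts (smem W) N"
    and SC: "{(num W k, num W (Suc k)) | k. True} \<subseteq> elts (smem W) N \<times> elts (smem W) N"
    unfolding N by auto
  obtain le where le: "rel_of (smem W) le = {(num W k, num W l) | k l. k \<le> l}"
    and star_le: "star_rel W {(num W k, num W l) | k l. k \<le> l} = rel_of (imem W) (star W le)"
    by (rule star_rel_obtain[OF LE])
  obtain lt where lt: "rel_of (smem W) lt = {(num W k, num W l) | k l. k < l}"
    and star_lt: "star_rel W {(num W k, num W l) | k l. k < l} = rel_of (imem W) (star W lt)"
    by (rule star_rel_obtain[OF LT])
  obtain sc where sc: "rel_of (smem W) sc = {(num W k, num W (Suc k)) | k. True}"
    and star_sc: "star_rel W {(num W k, num W (Suc k)) | k. True} = rel_of (imem W) (star W sc)"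
    by (rule star_rel_obtain[OF SC])
  have hnat: "hnat W = elts (imem W) (star W N)"
    unfolding hnat_def N[symmetric] by (rule star_set_elts)
  have hle: "hle W i j \<longleftrightarrow> (i, j) \<in> rel_of (imem W) (star W le)" for i j
    unfolding hle_def star_le ..
  have hless: "hless W i j \<longleftrightarrow> (i, j) \<in> rel_of (imem W) (star W lt)" for i j
    unfolding hless_def star_lt ..
  have "single_valued {(num W k, num W (Suc k)) | k. True}"
    by (auto simp: single_valued_def inj_eq[OF naturals(1)])
  then have "single_valued (rel_of (imem W) (star W sc))"
    using star_rel_single_valued[OF SC] star_sc by simp
  then have hsuc: "hsuc W i = k" if "(i, k) \<in> rel_of (imem W) (star W sc)" for i k
    unfolding hsuc_def star_sc using that by (rule THE_single_valued)
  have INF_sub: "INF_pts W Y \<subseteq> elts (imem W) (star W y)"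
    unfolding INF_pts_def y[symmetric] star_set_elts by blast
  obtain n s where s: "hyperfinite_seq W n s"
    and s_INF: "\<And>i. i \<in> hnat W \<Longrightarrow> hle W i n \<Longrightarrow> seq_at W s i \<in> INF_pts W Y"
    and s_0: "seq_at W s (star W (num W 0)) = a" and s_n: "seq_at W s n = z"
    and s_close: "\<And>i. i \<in> hnat W \<Longrightarrow> hless W i n \<Longrightarrow>
      finitely_close W Y (seq_at W s i) (seq_at W s (hsuc W i))"
    and z: "z \<in> INF_pts W Y"
    using az unfolding iota_equiv_def by blast
  have n: "n \<in> hnat W" and "internal W s" and s_pairs: "\<forall>p\<in>elts (imem W) s. \<exists>i z. is_pair (imem W) p i z"
    and s_sv: "single_valued (rel_of (imem W) s)"
    and s_dom: "Domain (rel_of (imem W) s) = {i \<in> hnat W. hle W i n}"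
    using s unfolding hyperfinite_seq_def by auto
  have s_at: "seq_at W s i = v" if "(i, v) \<in> rel_of (imem W) s" for i v
    unfolding seq_at_def using s_sv that by (rule THE_single_valued)
  have s_val: "i \<in> hnat W \<and> v \<in> INF_pts W Y" if iv: "(i, v) \<in> rel_of (imem W) s" for i v
  proof -
    have "i \<in> hnat W \<and> hle W i n" using iv s_dom by blast
    then show ?thesis using s_INF[of i] s_at[OF iv] by simp
  qed
  have seq: "seq_on (imem W) (star W N) (star W y) (star W le) n s"
    unfolding seq_on_iff
  proof (intro conjI)
    show "rel_of (imem W) s \<subseteq> elts (imem W) (star W N) \<times> elts (imem W) (star W y)"
      using s_val INF_sub hnat by auto
    show "Domain (rel_of (imem W) s) =
        {i \<in> elts (imem W) (star W N). (i, n) \<in> rel_of (imem W) (star W le)}"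
      using s_dom unfolding hnat hle .
  qed (fact s_pairs s_sv)+
  have "imem W n (star W N)" "imem W b (star W y)"
    using n b INF_sub hnat by (auto simp: elts_def)
  then obtain n' s' where n': "imem W n' (star W N)" and s': "internal W s'"
    and seq': "seq_on (imem W) (star W N) (star W y) (star W le) n' s'"
    and prep: "prepended (imem W) (star W N) (star W y) (star W lt) (star W sc) (star W (num W 0)) n s b n' s'"
    using internal_prepend[OF N le lt sc _ \<open>internal W s\<close> _ seq] by metis
  have s'_pairs: "\<forall>p\<in>elts (imem W) s'. \<exists>i z. is_pair (imem W) p i z"
    and s'_sub: "rel_of (imem W) s' \<subseteq> elts (imem W) (star W N) \<times> elts (imem W) (star W y)"
    and s'_sv: "single_valued (rel_of (imem W) s')"
    and s'_dom: "Domain (rel_of (imem W) s') = {i \<in> hnat W. hle W i n'}"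
    using seq' unfolding seq_on_iff hnat hle by blast+
  have s'_at: "seq_at W s' i = v" if "(i, v) \<in> rel_of (imem W) s'" for i v
    unfolding seq_at_def using s'_sv that by (rule THE_single_valued)
  have "hyperfinite_seq W n' s'"
    unfolding hyperfinite_seq_def using n' s' s'_pairs s'_sv s'_dom by (simp add: hnat elts_def)
  moreover have "seq_at W s' i \<in> INF_pts W Y" if i: "i \<in> hnat W" "hle W i n'" for i
  proof -
    have "i \<in> Domain (rel_of (imem W) s')" using i s'_dom by simp
    then obtain v where iv: "(i, v) \<in> rel_of (imem W) s'" by blast
    then have "imem W i (star W N)" "imem W v (star W y)" using s'_sub by (auto simp: elts_def)
    then have "v = b \<or> (\<exists>j. (j, v) \<in> rel_of (imem W) s)"
      using prep iv unfolding prepended_def by metis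
    then show ?thesis using s'_at[OF iv] s_val b by metis
  qed
  moreover have "seq_at W s' (star W (num W 0)) = b"
    using prep s'_at unfolding prepended_def by metis
  moreover have "seq_at W s' n' = z"
    using prep s'_at s_at s_n unfolding prepended_def by metis
  moreover have "finitely_close W Y (seq_at W s' i) (seq_at W s' (hsuc W i))"
    if i: "i \<in> hnat W" "hless W i n'" for i
  proof -
    have "imem W i (star W N)" "(i, n') \<in> rel_of (imem W) (star W lt)"
      using i by (simp_all add: hnat hless elts_def)
    then obtain k u v where "(i, k) \<in> rel_of (imem W) (star W sc)"
      and iu: "(i, u) \<in> rel_of (imem W) s'" and kv: "(k, v) \<in> rel_of (imem W) s'"
      and uv: "u = b \<and> (star W (num W 0), v) \<in> rel_of (imem W) s \<or>
        (\<exists>j l. imem W j (star W N) \<and> (j, n) \<in> rel_of (imem W) (star W lt) \<and>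
          (j, l) \<in> rel_of (imem W) (star W sc) \<and>
          (j, u) \<in> rel_of (imem W) s \<and> (l, v) \<in> rel_of (imem W) s)"
      using prep unfolding prepended_def by metis
    have eq: "seq_at W s' i = u" "seq_at W s' (hsuc W i) = v"
      using hsuc[OF \<open>(i, k) \<in> _\<close>] s'_at[OF iu] s'_at[OF kv] by simp_all
    have "finitely_close W Y u v"
      using uv
    proof
      assume "u = b \<and> (star W (num W 0), v) \<in> rel_of (imem W) s"
      then show ?thesis using s_at s_0 close by metis
    next
      assume "\<exists>j l. imem W j (star W N) \<and> (j, n) \<in> rel_of (imem W) (star W lt) \<and>
          (j, l) \<in> rel_of (imem W) (star W sc) \<and>
          (j, u) \<in> rel_of (imem W) s \<and> (l, v) \<in> rel_of (imem W) s"
      then obtain j l where j: "j \<in> hnat W" "hless W j n" "hsuc W j = l"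
        and "(j, u) \<in> rel_of (imem W) s" "(l, v) \<in> rel_of (imem W) s"
        using hsuc hless hnat unfolding elts_def by blast
      then show ?thesis using s_close[OF j(1,2)] s_at by simp
    qed
    then show ?thesis unfolding eq .
  qed
  ultimately show ?thesis
    unfolding iota_equiv_def using b z by blast
qed


section \<open>Extensions of coarse maps\<close>

lemma star_fun_rel:
  assumes A: "elts (smem W) a = A" and c: "A \<subseteq> elts (smem W) c" "f ` A \<subseteq> elts (smem W) c"
    and x: "x \<in> star_set W A"
  shows "(x, star_fun W A f x) \<in> star_rel W ((\<lambda>a. (a, f a)) ` A)"
proof -
  let ?F = "(\<lambda>a. (a, f a)) ` A"
  have F: "?F \<subseteq> elts (smem W) c \<times> elts (smem W) c" using c by auto
  have "single_valued (star_rel W ?F)"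
    using F by (rule star_rel_single_valued) (auto simp: single_valued_def)
  moreover have "x \<in> Domain (star_rel W ?F)"
  proof -
    have "elts (smem W) a \<subseteq> Domain ?F" using A by (auto simp: Domain_iff)
    then show ?thesis using star_rel_total[OF F] x unfolding A[symmetric] star_set_elts by blast
  qed
  then obtain w where w: "(x, w) \<in> star_rel W ?F" by blast
  ultimately have "star_fun W A f x = w"
    unfolding star_fun_def by (rule THE_single_valued)
  then show ?thesis using w by simp
qed

lemma star_fun_mem:
  assumes A: "elts (smem W) a = A" and B: "elts (smem W) b = B" and f: "f ` A \<subseteq> B"
    and x: "x \<in> star_set W A"
  shows "star_fun W A f x \<in> star_set W B"
proof -
  obtain c where c: "elts (smem W) c = elts (smem W) a \<union> elts (smem W) b"
    using union2_exists by blast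
  have sub: "A \<subseteq> elts (smem W) c" "f ` A \<subseteq> elts (smem W) c" using c A B f by auto
  have F: "(\<lambda>a. (a, f a)) ` A \<subseteq> elts (smem W) c \<times> elts (smem W) c" using sub by auto
  have "(\<lambda>a. (a, f a)) ` A \<subseteq> elts (smem W) a \<times> elts (smem W) b" using A B f by auto
  from star_rel_subset_Times[OF F this] star_fun_rel[OF A sub x]
  show ?thesis unfolding B[symmetric] star_set_elts by blast
qed

text \<open>
  If \<open>*f(x)\<close> is related to the base point by \<open>*E\<close>, then properness applied to the bounded set of all
  points \<open>E\<close>-related to the base point shows that \<open>x\<close> is finite.
\<close>

lemma star_fun_INF:
  assumes X: "standard_pcs W X" "pointed_coarse_space X"
    and Y: "standard_pcs W Y" "pointed_coarse_space Y"
    and f: "coarse_map X Y f" and x: "x \<in> INF_pts W X"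
  shows "star_fun W (pts X) f x \<in> INF_pts W Y"
proof -
  obtain a where a: "elts (smem W) a = pts X" using X(1) by (auto simp: standard_pcs_def)
  obtain b where b: "elts (smem W) b = pts Y" using Y(1) by (auto simp: standard_pcs_def)
  obtain c where c: "elts (smem W) c = pts X \<union> pts Y"
    using union2_exists[of a b] a b by auto
  have f_pts: "f ` pts X \<subseteq> pts Y" and f_base: "f (base X) = base Y" and "proper_map X Y f"
    using f by (auto simp: coarse_map_def pointed_map_def)
  have base: "base X \<in> pts X" "base Y \<in> pts Y"
    using X(2) Y(2) by (auto simp: pointed_coarse_space_def)
  have cX: "coarse_structure (pts X) (ents X)" and cY: "coarse_structure (pts Y) (ents Y)"
    using X(2) Y(2) by (auto simp: pointed_coarse_space_def)
  have xX: "x \<in> star_set W (pts X)" using x by (simp add: INF_pts_def)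
  let ?F = "(\<lambda>a. (a, f a)) ` pts X"
  have Fx: "(x, star_fun W (pts X) f x) \<in> star_rel W ?F"
    using c f_pts xX by (intro star_fun_rel[OF a, of c]) auto
  have F: "?F \<subseteq> elts (smem W) c \<times> elts (smem W) c" using c f_pts by auto
  have "\<not> finitely_close W Y (star_fun W (pts X) f x) (star W (base Y))"
  proof
    assume "finitely_close W Y (star_fun W (pts X) f x) (star W (base Y))"
    then obtain E where E: "E \<in> ents Y" and fxE: "(star_fun W (pts X) f x, star W (base Y)) \<in> star_rel W E"
      unfolding finitely_close_def by blast
    have EY: "E \<subseteq> pts Y \<times> pts Y" using cY E by (auto simp: coarse_structure_def)
    define B where "B = insert (base Y) {v. (v, base Y) \<in> E}"
    define D where "D = f -` B \<inter> pts X"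
    \<comment> \<open>The diagonal is added because the base point, which belongs to \<open>B\<close>, need not be \<open>E\<close>-related to itself.\<close>
    let ?E = "E \<union> Id_on (pts Y)"
    have "?E O ?E\<inverse> \<in> ents Y" using cY E by (simp add: coarse_structure_def)
    moreover have "B \<times> B \<subseteq> ?E O ?E\<inverse>" using base by (auto simp: B_def)
    ultimately have "B \<times> B \<in> ents Y" using cY unfolding coarse_structure_def by blast
    then have "bounded_set Y B" using EY base by (auto simp: bounded_set_def B_def)
    then have "D \<times> D \<in> ents X"
      using \<open>proper_map X Y f\<close> by (auto simp: proper_map_def bounded_set_def B_def D_def)
    have "base X \<in> D" using base f_base by (simp add: D_def B_def)
    have E': "E \<subseteq> elts (smem W) c \<times> elts (smem W) c" using EY c by auto
    have DD: "D \<times> D \<subseteq> elts (smem W) c \<times> elts (smem W) c" using c by (auto simp: D_def)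
    \<comment> \<open>Composing with this pair replaces the base point of \<open>Y\<close> by that of \<open>X\<close>, so that \<open>f\<close>, \<open>E\<close> and
      the pair compose to a subset of \<open>D \<times> D\<close>.\<close>
    let ?G = "{(base Y, base X)}"
    have G: "?G \<subseteq> elts (smem W) c \<times> elts (smem W) c" using base c by auto
    have EG: "E O ?G \<subseteq> elts (smem W) c \<times> elts (smem W) c" using E' G by blast
    have "?F O (E O ?G) \<subseteq> D \<times> D"
      using \<open>base X \<in> D\<close> by (auto simp: D_def B_def)
    then have "star_rel W ?F O star_rel W (E O ?G) \<subseteq> star_rel W (D \<times> D)"
      by (rule star_rel_comp[OF F EG DD])
    moreover have "star_rel W E O star_rel W ?G \<subseteq> star_rel W (E O ?G)"
      by (rule star_rel_comp[OF E' G EG order_refl])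
    moreover have "(star W (base Y), star W (base X)) \<in> star_rel W ?G"
      by (rule star_rel_mem[OF G]) simp
    ultimately have "(x, star W (base X)) \<in> star_rel W (D \<times> D)"
      using Fx fxE by blast
    then have "x \<in> FIN_pts W X"
      using \<open>D \<times> D \<in> ents X\<close> xX unfolding FIN_pts_def finitely_close_def by blast
    then show False using x by (simp add: INF_pts_def)
  qed
  moreover have "star_fun W (pts X) f x \<in> star_set W (pts Y)"
    using a b f_pts xX by (rule star_fun_mem)
  ultimately show ?thesis by (simp add: INF_pts_def FIN_pts_def)
qed

text \<open>If \<open>F\<close>, \<open>G\<close> are the graphs and \<open>H = {(f(a), g(a)) | a \<in> X}\<close>, then \<open>F\<inverse> O G \<subseteq> H\<close> transfers.\<close>

lemma star_fun_close:
  assumes X: "standard_pcs W X" and Y: "standard_pcs W Y" "pointed_coarse_space Y"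
    and f: "f ` pts X \<subseteq> pts Y" and g: "g ` pts X \<subseteq> pts Y" and fg: "bornotopic X Y f g"
    and x: "x \<in> star_set W (pts X)"
  shows "finitely_close W Y (star_fun W (pts X) f x) (star_fun W (pts X) g x)"
proof -
  obtain a where a: "elts (smem W) a = pts X" using X by (auto simp: standard_pcs_def)
  obtain b where b: "elts (smem W) b = pts Y" using Y(1) by (auto simp: standard_pcs_def)
  obtain c where c: "elts (smem W) c = pts X \<union> pts Y"
    using union2_exists[of a b] a b by auto
  let ?F = "(\<lambda>a. (a, f a)) ` pts X" and ?G = "(\<lambda>a. (a, g a)) ` pts X"
  let ?H = "{(f x, g x) | x. x \<in> pts X}"
  have F: "?F \<subseteq> elts (smem W) c \<times> elts (smem W) c" and F': "?F\<inverse> \<subseteq> elts (smem W) c \<times> elts (smem W) c"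
    and G: "?G \<subseteq> elts (smem W) c \<times> elts (smem W) c" and H: "?H \<subseteq> elts (smem W) c \<times> elts (smem W) c"
    using c f g by auto
  have "(x, star_fun W (pts X) f x) \<in> star_rel W ?F"
    using c f x by (intro star_fun_rel[OF a, of c]) auto
  then have "(star_fun W (pts X) f x, x) \<in> star_rel W (?F\<inverse>)"
    using star_rel_converse[OF F] by blast
  moreover have "(x, star_fun W (pts X) g x) \<in> star_rel W ?G"
    using c g x by (intro star_fun_rel[OF a, of c]) auto
  moreover have "star_rel W (?F\<inverse>) O star_rel W ?G \<subseteq> star_rel W ?H"
    using F' G H by (rule star_rel_comp) auto
  ultimately have "(star_fun W (pts X) f x, star_fun W (pts X) g x) \<in> star_rel W ?H" by blast
  then show ?thesis using fg unfolding finitely_close_def bornotopic_def by blast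
qed

lemma iota_class_star_fun_subset:
  assumes X: "standard_pcs W X" "pointed_coarse_space X"
    and Y: "standard_pcs W Y" "pointed_coarse_space Y"
    and f: "coarse_map X Y f" and g: "coarse_map X Y g"
    and gf: "bornotopic X Y g f" and x: "x \<in> INF_pts W X"
  shows "iota_class W Y (star_fun W (pts X) f x) \<subseteq> iota_class W Y (star_fun W (pts X) g x)"
proof -
  obtain b where b: "elts (smem W) b = pts Y" using Y(1) by (auto simp: standard_pcs_def)
  have "finitely_close W Y (star_fun W (pts X) g x) (star_fun W (pts X) f x)"
    using X(1) Y _ _ gf
    by (rule star_fun_close) (use f g x in \<open>auto simp: coarse_map_def pointed_map_def INF_pts_def\<close>)
  then show ?thesis
    unfolding iota_class_def
    using iota_equiv_prepend[OF b star_fun_INF[OF X Y g x]] by blast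
qed

end

lemma bornotopic_sym:
  assumes "pointed_coarse_space Y" and "bornotopic X Y f g"
  shows "bornotopic X Y g f"
proof -
  have "{(f x, g x) | x. x \<in> pts X}\<inverse> \<in> ents Y"
    using assms by (auto simp: bornotopic_def pointed_coarse_space_def coarse_structure_def)
  moreover have "{(f x, g x) | x. x \<in> pts X}\<inverse> = {(g x, f x) | x. x \<in> pts X}" by blast
  ultimately show ?thesis by (simp add: bornotopic_def)
qed

theorem theorem3p11:
  fixes W :: "('u, 'v) universes"
    and X Y :: "'u pcs"
    and f g :: "'u \<Rightarrow> 'u"
  assumes "nonstandard_universe W"
    and "pointed_coarse_space X" and "standard_pcs W X"
    and "pointed_coarse_space Y" and "standard_pcs W Y"
    and "coarse_map X Y f" and "coarse_map X Y g"
    and "bornotopic X Y f g"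
  shows "iota_map W X Y f = iota_map W X Y g"
proof -
  interpret nonstandard_universe W by fact
  have eq: "iota_class W Y (star_fun W (pts X) f x) = iota_class W Y (star_fun W (pts X) g x)"
    if "x \<in> INF_pts W X" for x
    using assms bornotopic_sym that by (intro subset_antisym iota_class_star_fun_subset) auto
  have "(\<lambda>x. iota_class W Y (star_fun W (pts X) f x)) ` c =
      (\<lambda>x. iota_class W Y (star_fun W (pts X) g x)) ` c" if "c \<in> iota W X" for c
  proof (rule image_cong[OF refl])
    fix x assume "x \<in> c"
    then have "x \<in> INF_pts W X"
      using that by (auto simp: iota_def iota_class_def iota_equiv_def)
    then show "iota_class W Y (star_fun W (pts X) f x) = iota_class W Y (star_fun W (pts X) g x)"
      by (rule eq)
  qed
  then show ?thesis
    unfolding iota_map_def by (intro restrict_ext) simp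
qed

end
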